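(* Let $1\le p\le\infty$ and let $A,B:L_p(\mathbb{R},\mu)\to L_p(\mathbb{R},\mu)$ be the operators defined, for almost every $t$, by $$(Ax)(t)=\int_{\alpha_1}^{\beta_1}I_{[\alpha,\beta]}(t)\Big(\theta_{A,1}\sin(\omega t)\cos(\omega s)+\theta_{A,2}\cos(\omega t)\cos(\omega s)+\frac{\delta\theta_{A,2}^2\sigma_2^2}{\sigma_1}\sin(\omega t)\sin(\omega s)\Big)x(s)\,d\mu_s,$$ $$(Bx)(t)=\int_{\alpha_1}^{\beta_1}I_{[\alpha,\beta]}(t)\,\theta_{B,1}\sin(\omega t)\cos(\omega s)x(s)\,d\mu_s,$$ where $\theta_{A,1},\theta_{A,2},\theta_{B,1},\omega\in\mathbb{R}$, $\delta\in\mathbb{R}\setminus\{0\}$, $\alpha,\beta,\alpha_1,\beta_1\in\mathbb{R}$, $\alpha_1<\beta_1$, $\alpha\le\alpha_1$, $\beta\ge\beta_1$, either $\frac{\omega}{\pi}(\beta_1-\alpha_1)\in\mathbb{Z}$ or $\frac{\omega}{\pi}(\beta_1+\alpha_1)\in\mathbb{Z}$, and $\sigma_1\ne0$, $\sigma_2\neq0$. Let $\{\theta_n\}$ and $\{\varsigma_n\}$ be sequences of real numbers and let $A_n,B_n:L_p(\mathbb{R},\mu)\to L_p(\mathbb{R},\mu)$ be defined, for almost every $t$, by $$(A_nx)(t)=\int_{\alpha_1}^{\beta_1}I_{[\alpha,\beta]}(t)\Big(\theta_{A,1}\sin(\omega t)\cos(\omega s)+\theta_n\cos(\omega t)\cos(\omega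 s)+\frac{\delta\theta_n^2\sigma_2^2}{\sigma_1}\sin(\omega t)\sin(\omega s)\Big)x(s)\,d\mu_s,$$ $$(B_nx)(t)=\int_{\alpha_1}^{\beta_1}I_{[\alpha,\beta]}(t)\,\varsigma_n\sin(\omega t)\cos(\omega s)x(s)\,d\mu_s.$$ Then: 1. $AB=\delta BA^2$, $A_nB=\delta BA_n^2$, $A_nB_n=\delta B_nA_n^2$ and $AB_n=\delta B_nA^2$ for each positive integer $n$. Moreover, for all $x\in L_p(\mathbb{R},\mu)$ and almost every $t$, $$(AB-BA)x(t)=\theta_{A,2}\sigma_2\theta_{B,1}(\delta\theta_{A,2}\sigma_2-1)\int_{\alpha_1}^{\beta_1}I_{[\alpha,\beta]}(t)\sin(\omega t)\cos(\omega s)x(s)\,d\mu_s.$$ 2. If $\theta_n\to0$ as $n\to\infty$, then $A_n\to\bar A$ in norm, where $(\bar Ax)(t)=\int_{\alpha_1}^{\beta_1}I_{[\alpha,\beta]}(t)\theta_{A,1}\sin(\omega t)\cos(\omega s)x(s)\,d\mu_s$ for almost every $t$, so $A_nB-BA_n\to0$ in norm and $\bar AB=B\bar A$. 3. If $\theta_n\to\frac{1}{\delta\sigma_2}$ as $n\to\infty$, then $A_n\to\tilde A$ in norm, where, for almost every $t$, $$(\tilde Ax)(t)=\int_{\alpha_1}^{\beta_1}I_{[\alpha,\beta]}(t)\Big(\theta_{A,1}\sin(\omega t)\cos(\omega s)+\frac{1}{\delta\sigma_2}\cos(\omega t)\cos(\omega s)+\frac{1}{\delta\sigma_1}\sin(\omega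 t)\sin(\omega s)\Big)x(s)\,d\mu_s,$$ so $A_nB-BA_n\to0$ in norm and $\tilde AB=B\tilde A$. 4. If $\varsigma_n\to0$ as $n\to\infty$, then $B_n\to0$ in norm and so $AB_n-B_nA\to0$ in norm. 5. If (either $\theta_n\to0$ or $\theta_n\to\frac{1}{\delta\sigma_2}$) and $\varsigma_n\to0$ as $n\to\infty$, then $A_nB_n-B_nA_n\to0$ in norm. 6. Let $\lambda_0\in\mathrm{cl}(\Lambda)$. If $\theta_{A,2}\sigma_2\theta_{B,1}(\delta\theta_{A,2}\sigma_2-1)\tilde\lambda\to0$ when $(\theta_{A,1},\theta_{A,2},\theta_{B,1},\alpha_1,\beta_1,\alpha,\beta,\sigma_1,\sigma_2,\delta,\omega)\to\lambda_0$ within $\Lambda$, then for all $x\in L_p(\mathbb{R},\mu)$ it holds that $\|(AB-BA)x\|_{L_p}\to0$ (along the same limit of parameters, $A$ and $B$ being the operators with these parameters).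
   Context: $\mu$ is Lebesgue measure on $\mathbb{R}$; $L_p(\mathbb{R},\mu)$ is the real Lebesgue space; the index in $d\mu_s$ indicates the variable of integration; $I_E$ is the indicator function of the set $E$; convergence in norm means convergence in the operator norm on $L_p(\mathbb{R},\mu)$. The constants are $$\sigma_1=\int_{\alpha_1}^{\beta_1}(\sin(\omega s))^2d\mu_s,\qquad \sigma_2=\int_{\alpha_1}^{\beta_1}(\cos(\omega s))^2d\mu_s=\beta_1-\alpha_1-\sigma_1.$$ The parameter set is $$\Lambda=\Big\{(\theta_{A,1},\theta_{A,2},\theta_{B,1},\alpha_1,\beta_1,\alpha,\beta,\sigma_1,\sigma_2,\delta,\omega)\in\mathbb{R}^{11}:\ \delta\ne0,\ \alpha_1<\beta_1,\ \alpha\le\alpha_1,\ \beta\ge\beta_1,\ \int_{\alpha_1}^{\beta_1}\sin(\omega s)\cos(\omega s)d\mu_s=0,\ \sigma_1=\int_{\alpha_1}^{\beta_1}(\sin(\omega s))^2d\mu_s\ne0,\ \sigma_2=\beta_1-\alpha_1-\sigma_1\ne0\Big\},$$ and $\mathrm{cl}(\Lambda)$ is its closure in $\mathbb{R}^{11}$. Further, $\tilde\lambda=|\beta-\alpha|^{1/p}|\beta_1-\alpha_1|^{1/q}$ with $\frac1p+\frac1q=1$ if $1<p<\infty$, $\tilde\lambda=|\beta_1-\alpha_1|$ if $p=\infty$, and $\tilde\lambda=|\beta-\alpha|$ if $p=1$. *)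

theory Defs
  imports "HOL-Analysis.Analysis" "HOL-Probability.Essential_Supremum"
begin

text \<open>
  Elements of $L_p$ are represented by measurable functions; equality in $L_p$ is equality
  almost everywhere. The exponent ranges over the extended reals in $[1, \infty]$.
\<close>

definition Lp_space :: "ennreal \<Rightarrow> (real \<Rightarrow> real) set" where
  "Lp_space p =
     {x \<in> borel_measurable lebesgue.
        if p = \<infinity> then esssup lebesgue (\<lambda>t. ennreal \<bar>x t\<bar>) < \<infinity>
        else integrable lebesgue (\<lambda>t. \<bar>x t\<bar> powr enn2real p)}"

text \<open>Only meaningful on \<^term>\<open>Lp_space p\<close>.\<close>

definition Lp_norm :: "ennreal \<Rightarrow> (real \<Rightarrow> real) \<Rightarrow> real" where
  "Lp_norm p x =
     (if p = \<infinity> then enn2real (esssup lebesgue (\<lambda>t. ennreal \<bar>x t\<bar>))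
      else (LINT t|lebesgue. \<bar>x t\<bar> powr enn2real p) powr (1 / enn2real p))"

text \<open>
  Bounded linear operators on $L_p$, given by their action on representatives: compatible with
  equality almost everywhere, and linear up to it.
\<close>

definition Lp_operator :: "ennreal \<Rightarrow> ((real \<Rightarrow> real) \<Rightarrow> real \<Rightarrow> real) \<Rightarrow> bool" where
  "Lp_operator p T \<longleftrightarrow>
     (\<forall>x\<in>Lp_space p. T x \<in> Lp_space p) \<and>
     (\<forall>x\<in>Lp_space p. \<forall>y\<in>Lp_space p.
        (AE t in lebesgue. x t = y t) \<longrightarrow> (AE t in lebesgue. T x t = T y t)) \<and>
     (\<forall>x\<in>Lp_space p. \<forall>y\<in>Lp_space p.
        AE t in lebesgue. T (\<lambda>s. x s + y s) t = T x t + T y t) \<and>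
     (\<forall>c. \<forall>x\<in>Lp_space p. AE t in lebesgue. T (\<lambda>s. c * x s) t = c * T x t) \<and>
     (\<exists>C. \<forall>x\<in>Lp_space p. Lp_norm p (T x) \<le> C * Lp_norm p x)"

definition Lp_op_eq ::
  "ennreal \<Rightarrow> ((real \<Rightarrow> real) \<Rightarrow> real \<Rightarrow> real) \<Rightarrow> ((real \<Rightarrow> real) \<Rightarrow> real \<Rightarrow> real) \<Rightarrow> bool" where
  "Lp_op_eq p S T \<longleftrightarrow> (\<forall>x\<in>Lp_space p. AE t in lebesgue. S x t = T x t)"

text \<open>Only meaningful if \<^term>\<open>Lp_operator p T\<close>; otherwise the supremum may be unspecified.\<close>

definition Lp_opnorm :: "ennreal \<Rightarrow> ((real \<Rightarrow> real) \<Rightarrow> real \<Rightarrow> real) \<Rightarrow> real" where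
  "Lp_opnorm p T = (SUP x\<in>{x \<in> Lp_space p. Lp_norm p x \<le> 1}. Lp_norm p (T x))"

definition Lp_op_tendsto ::
  "ennreal \<Rightarrow> (nat \<Rightarrow> (real \<Rightarrow> real) \<Rightarrow> real \<Rightarrow> real) \<Rightarrow> ((real \<Rightarrow> real) \<Rightarrow> real \<Rightarrow> real) \<Rightarrow> bool" where
  "Lp_op_tendsto p T S \<longleftrightarrow>
     (\<forall>n. Lp_operator p (T n)) \<and> Lp_operator p S \<and>
     (\<lambda>n. Lp_opnorm p (T n - S)) \<longlonglongrightarrow> 0"

definition kernel_op ::
  "real \<Rightarrow> real \<Rightarrow> (real \<Rightarrow> real \<Rightarrow> real) \<Rightarrow> (real \<Rightarrow> real) \<Rightarrow> real \<Rightarrow> real" where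
  "kernel_op \<alpha>1 \<beta>1 K x t = (LINT s:{\<alpha>1..\<beta>1}|lebesgue. K t s * x s)"

definition op_A ::
  "real \<Rightarrow> real \<Rightarrow> real \<Rightarrow> real \<Rightarrow> real \<Rightarrow> real \<Rightarrow> real \<Rightarrow> real \<Rightarrow> real \<Rightarrow> real \<Rightarrow>
     (real \<Rightarrow> real) \<Rightarrow> real \<Rightarrow> real" where
  "op_A \<theta>A1 \<theta>A2 \<alpha>1 \<beta>1 \<alpha> \<beta> \<sigma>1 \<sigma>2 \<delta> \<omega> =
     kernel_op \<alpha>1 \<beta>1 (\<lambda>t s. indicator {\<alpha>..\<beta>} t *
       (\<theta>A1 * sin (\<omega> * t) * cos (\<omega> * s) + \<theta>A2 * cos (\<omega> * t) * cos (\<omega> * s)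
        + \<delta> * \<theta>A2\<^sup>2 * \<sigma>2\<^sup>2 / \<sigma>1 * sin (\<omega> * t) * sin (\<omega> * s)))"

definition op_B ::
  "real \<Rightarrow> real \<Rightarrow> real \<Rightarrow> real \<Rightarrow> real \<Rightarrow> real \<Rightarrow> (real \<Rightarrow> real) \<Rightarrow> real \<Rightarrow> real" where
  "op_B \<theta>B1 \<alpha>1 \<beta>1 \<alpha> \<beta> \<omega> =
     kernel_op \<alpha>1 \<beta>1 (\<lambda>t s. indicator {\<alpha>..\<beta>} t * (\<theta>B1 * sin (\<omega> * t) * cos (\<omega> * s)))"

text \<open>Tuples are ordered as
  $(\theta_{A,1}, \theta_{A,2}, \theta_{B,1}, \alpha_1, \beta_1, \alpha, \beta,
  \sigma_1, \sigma_2, \delta, \omega)$; the product topology is that of $\mathbb{R}^{11}$.\<close>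

type_synonym params =
  "real \<times> real \<times> real \<times> real \<times> real \<times> real \<times> real \<times> real \<times> real \<times> real \<times> real"

definition Lambda_set :: "params set" where
  "Lambda_set = {(\<theta>A1, \<theta>A2, \<theta>B1, \<alpha>1, \<beta>1, \<alpha>, \<beta>, \<sigma>1, \<sigma>2, \<delta>, \<omega>).
     \<delta> \<noteq> 0 \<and> \<alpha>1 < \<beta>1 \<and> \<alpha> \<le> \<alpha>1 \<and> \<beta> \<ge> \<beta>1 \<and>
     (LINT s:{\<alpha>1..\<beta>1}|lebesgue. sin (\<omega> * s) * cos (\<omega> * s)) = 0 \<and>
     \<sigma>1 = (LINT s:{\<alpha>1..\<beta>1}|lebesgue. (sin (\<omega> * s))\<^sup>2) \<and> \<sigma>1 \<noteq> 0 \<and>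
     \<sigma>2 = \<beta>1 - \<alpha>1 - \<sigma>1 \<and> \<sigma>2 \<noteq> 0}"

definition lambda_tilde :: "ennreal \<Rightarrow> real \<Rightarrow> real \<Rightarrow> real \<Rightarrow> real \<Rightarrow> real" where
  "lambda_tilde p \<alpha>1 \<beta>1 \<alpha> \<beta> =
     (if p = \<infinity> then \<bar>\<beta>1 - \<alpha>1\<bar>
      else if p = 1 then \<bar>\<beta> - \<alpha>\<bar>
      else let r = enn2real p; q = r / (r - 1)  \<comment> \<open>the solution of \<open>1 / r + 1 / q = 1\<close>\<close>
           in \<bar>\<beta> - \<alpha>\<bar> powr (1 / r) * \<bar>\<beta>1 - \<alpha>1\<bar> powr (1 / q))"

end

theory Submission
  imports Defs
begin

text \<open>
  Write \<open>u\<close> and \<open>v\<close> for \<open>sin (\<omega> t)\<close> and \<open>cos (\<omega> t)\<close> cut off to \<open>[\<alpha>, \<beta>]\<close>, and \<open>S x\<close>, \<open>C x\<close> for the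
  integrals of \<open>sin (\<omega> s) x(s)\<close> and \<open>cos (\<omega> s) x(s)\<close> over the window \<open>[\<alpha>1, \<beta>1]\<close>. Every operator in
  the theorem has rank at most two and the shape \<open>x \<mapsto> (a C x + d S x) u + b (C x) v\<close>, so it is
  described by three numbers \<open>(a, b, d)\<close>. Since \<open>u\<close> and \<open>v\<close> are orthogonal on the window, with squared
  norms \<open>\<sigma>1\<close> and \<open>\<sigma>2\<close>, the shape is stable under composition, with the law
  \<open>(a, b, d) (a', b', d') = (a \<sigma>2 b' + d \<sigma>1 a', b \<sigma>2 b', d \<sigma>1 d')\<close>: up to the weights \<open>\<sigma>1\<close>, \<open>\<sigma>2\<close> this is
  the multiplication of upper triangular \<open>2 \<times> 2\<close> matrices (lemma \<open>has_coeffs_comp\<close>). The algebraic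
  claims then become identities between real numbers. With \<open>A = (a, b, \<delta> b\<^sup>2 \<sigma>2\<^sup>2 / \<sigma>1)\<close> and
  \<open>B = (c, 0, 0)\<close> both \<open>A B\<close> and \<open>\<delta> B A\<^sup>2\<close> are \<open>(\<delta> b\<^sup>2 \<sigma>2\<^sup>2 c, 0, 0)\<close>, and the commutator is
  \<open>(b \<sigma>2 c (\<delta> b \<sigma>2 - 1), 0, 0)\<close>, whose zeros \<open>b = 0\<close>, \<open>b = 1 / (\<delta> \<sigma>2)\<close> and \<open>c = 0\<close> are the limits considered in the theorem.

  For the analytic claims, Hoelder's inequality on the window bounds \<open>C x\<close> and \<open>S x\<close> by the \<open>L\<^sub>p\<close> norm of
  \<open>x\<close> times a power of the window length, while \<open>u\<close> and \<open>v\<close> are bounded by the indicator function of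
  \<open>[\<alpha>, \<beta>]\<close>. Together they give operator norm at most \<open>(\<bar>a\<bar> + \<bar>b\<bar> + \<bar>d\<bar>) \<lambda>\<close>, where \<open>\<lambda>\<close> is the constant
  \<^const>\<open>lambda_tilde\<close> (lemma \<open>has_coeffs_Lp_bound\<close>). Hence convergence of the three coefficients implies
  convergence in norm, and for variable parameters the commutator is controlled by its coefficient
  times \<open>\<lambda>\<close>, which is the quantity assumed to tend to zero.
\<close>

section \<open>Norm estimates on intervals\<close>

text \<open>
  The graph of the convex function \<open>t powr r\<close> lies above its tangent at \<open>c\<close>. Integrating this
  inequality and choosing \<open>c\<close> optimally yields Hoelder's inequality against a constant.
\<close>

lemma le_tangent_powr:
  fixes t c r :: real
  assumes "1 \<le> r" "0 < c" "0 \<le> t"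
  shows "t \<le> c powr (1 - r) / r * t powr r + (1 - 1 / r) * c"
proof (cases "t = 0")
  case True
  then show ?thesis using assms by simp
next
  case False
  have "(c powr (1 - r) * t powr r) powr (1 / r) * c powr (1 - 1 / r)
      = c powr ((1 - r) * (1 / r) + (1 - 1 / r)) * t powr (r * (1 / r))"
    using assms by (simp add: powr_mult powr_powr powr_add)
  also have "(1 - r) * (1 / r) + (1 - 1 / r) = 0"
    using assms by (simp add: field_simps)
  also have "r * (1 / r) = 1" using assms by simp
  finally have "(c powr (1 - r) * t powr r) powr (1 / r) * c powr (1 - 1 / r) = t"
    using assms by simp
  moreover have "(c powr (1 - r) * t powr r) powr (1 / r) * c powr (1 - 1 / r)
      \<le> 1 / r * (c powr (1 - r) * t powr r) + (1 - 1 / r) * c"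
    using assms False by (intro Youngs_inequality_0) auto
  ultimately show ?thesis by simp
qed

lemma Lp_norm_nonneg: "0 \<le> Lp_norm p x"
  by (simp add: Lp_norm_def)

lemma AE_abs_le_Lp_norm_infinity:
  assumes "x \<in> Lp_space \<infinity>"
  shows "AE t in lebesgue. \<bar>x t\<bar> \<le> Lp_norm \<infinity> x"
proof -
  let ?E = "esssup lebesgue (\<lambda>t. ennreal \<bar>x t\<bar>)"
  have "?E < \<infinity>" using assms by (simp add: Lp_space_def)
  then have "?E = ennreal (Lp_norm \<infinity> x)"
    by (simp add: Lp_norm_def)
  with esssup_AE[of "\<lambda>t. ennreal \<bar>x t\<bar>" lebesgue] show ?thesis
    by (auto simp: Lp_norm_nonneg)
qed

lemma enn2real_ge_1:
  assumes "1 \<le> p" "p \<noteq> \<infinity>"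
  shows "1 \<le> enn2real p"
  using enn2real_mono[of 1 p] assms by (simp add: less_top[symmetric])

text \<open>
  Hoelder's inequality for the pair \<open>x\<close>, \<open>1\<close> on an interval. The formula also covers \<open>p = \<infinity>\<close>:
  \<^const>\<open>enn2real\<close> maps \<open>\<infinity>\<close> to \<open>0\<close> and division by zero yields \<open>0\<close>, so that \<open>1 / enn2real p\<close> is the
  intended value of \<open>1 / p\<close> in all cases.
\<close>

lemma Lp_integral_abs_le:
  assumes p: "1 \<le> p" and ab: "a < b" and x: "x \<in> Lp_space p"
  shows "set_integrable lebesgue {a..b} x"
    and "(LINT s:{a..b}|lebesgue. \<bar>x s\<bar>) \<le> Lp_norm p x * (b - a) powr (1 - 1 / enn2real p)"
proof -
  have xm [measurable]: "x \<in> borel_measurable lebesgue"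
    using x by (simp add: Lp_space_def)
  have xs: "set_borel_measurable lebesgue {a..b} x"
    unfolding set_borel_measurable_def
    by (intro borel_measurable_scaleR borel_measurable_indicator xm) auto
  have const: "set_integrable lebesgue {a..b} (\<lambda>s. k)" "(LINT s:{a..b}|lebesgue. k) = k * (b - a)"
    for k :: real
    using ab by (auto simp: set_integral_const set_integrable_def)
  have "set_integrable lebesgue {a..b} x \<and>
    (LINT s:{a..b}|lebesgue. \<bar>x s\<bar>) \<le> Lp_norm p x * (b - a) powr (1 - 1 / enn2real p)"
  proof (cases "p = \<infinity>")
    case True
    have ae: "AE s in lebesgue. \<bar>x s\<bar> \<le> Lp_norm p x"
      using AE_abs_le_Lp_norm_infinity x True by simp
    have int: "set_integrable lebesgue {a..b} x"
      by (rule set_integrable_bound[OF const(1)[of "Lp_norm p x"]])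
        (use ae xs in auto)
    have "(LINT s:{a..b}|lebesgue. \<bar>x s\<bar>) \<le> (LINT s:{a..b}|lebesgue. Lp_norm p x)"
      using ae by (intro set_integral_mono_AE set_integrable_abs int const) auto
    with int show ?thesis
      using ab True by (simp only: const) simp
  next
    case False
    define r where "r = enn2real p"
    define J where "J = (LINT t|lebesgue. \<bar>x t\<bar> powr r)"
    have r: "1 \<le> r" using enn2real_ge_1 p False by (simp add: r_def)
    have ir: "integrable lebesgue (\<lambda>t. \<bar>x t\<bar> powr r)"
      using x False by (simp add: Lp_space_def r_def)
    have sr: "set_integrable lebesgue {a..b} (\<lambda>t. \<bar>x t\<bar> powr r)"
      unfolding set_integrable_def using ir by (intro integrable_mult_indicator) auto
    have sJ: "(LINT s:{a..b}|lebesgue. \<bar>x s\<bar> powr r) \<le> J"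
      unfolding J_def set_lebesgue_integral_def using ir sr
      by (intro integral_mono) (auto simp: set_integrable_def indicator_def)
    have J0: "0 \<le> J" by (simp add: J_def)
    have N: "Lp_norm p x = J powr (1 / r)"
      using False by (simp add: Lp_norm_def J_def r_def)
    have maj: "set_integrable lebesgue {a..b}
        (\<lambda>s. c powr (1 - r) / r * \<bar>x s\<bar> powr r + (1 - 1 / r) * c)" for c
      by (intro set_integral_add(1) set_integrable_mult_right const sr)
    have int: "set_integrable lebesgue {a..b} x"
      by (rule set_integrable_bound[OF maj[of 1]])
        (use r le_tangent_powr[of r 1] xs in \<open>auto intro: order_trans\<close>)
    have le: "(LINT s:{a..b}|lebesgue. \<bar>x s\<bar>) \<le> c powr (1 - r) / r * J + (1 - 1 / r) * c * (b - a)"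
      if "0 < c" for c
    proof -
      have "(LINT s:{a..b}|lebesgue. \<bar>x s\<bar>)
          \<le> (LINT s:{a..b}|lebesgue. c powr (1 - r) / r * \<bar>x s\<bar> powr r + (1 - 1 / r) * c)"
        using r that by (intro set_integral_mono set_integrable_abs int maj le_tangent_powr) auto
      also have "\<dots> = c powr (1 - r) / r * (LINT s:{a..b}|lebesgue. \<bar>x s\<bar> powr r)
          + (1 - 1 / r) * c * (b - a)"
        by (subst set_integral_add(2))
          (intro set_integrable_mult_right const sr | simp only: set_integral_mult_right const)+
      also have "\<dots> \<le> c powr (1 - r) / r * J + (1 - 1 / r) * c * (b - a)"
        using r sJ by (intro add_right_mono mult_left_mono) auto
      finally show ?thesis .
    qed
    have "(LINT s:{a..b}|lebesgue. \<bar>x s\<bar>) \<le> J powr (1 / r) * (b - a) powr (1 - 1 / r)"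
      (* A vanishing norm has no optimal tangent point; there c tends to 0 instead. *)
    proof (cases "J = 0")
      case True
      have "((\<lambda>c. (1 - 1 / r) * c * (b - a)) \<longlongrightarrow> (1 - 1 / r) * 0 * (b - a)) (at_right 0)"
        by (intro tendsto_intros)
      then have "(LINT s:{a..b}|lebesgue. \<bar>x s\<bar>) \<le> (1 - 1 / r) * 0 * (b - a)"
        by (rule tendsto_lowerbound)
          (use le True in \<open>auto simp: eventually_at_right_less intro!: eventually_mono[OF eventually_at_right_less]\<close>)
      then show ?thesis using True by simp
    next
      case False
      (* With n the norm of x and m the r-th root of the interval length, both terms of the
         bound at c = n / m are multiples of n * m powr (r - 1), with weights adding up to 1. *)
      define n where "n = J powr (1 / r)"
      define m where "m = (b - a) powr (1 / r)"
      have nm: "0 < n" "0 < m" using False ab by (auto simp: n_def m_def)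
      have Jn: "J = n powr r" using r J0 by (simp add: n_def powr_powr)
      have bm: "b - a = m powr r" using r ab by (simp add: m_def powr_powr)
      have pw: "y powr (1 - r) * y powr r = y" if "0 < y" for y :: real
        using that by (simp flip: powr_add)
      have "(n / m) powr (1 - r) * J = n * m powr (r - 1)"
        using pw[of n] nm by (simp add: Jn powr_divide powr_diff field_simps)
      moreover have "n / m * (b - a) = n * m powr (r - 1)"
        using nm by (simp add: bm powr_diff)
      moreover have "m powr (r - 1) = (b - a) powr (1 - 1 / r)"
        using r by (simp add: m_def powr_powr field_simps)
      moreover have "(LINT s:{a..b}|lebesgue. \<bar>x s\<bar>)
          \<le> 1 / r * ((n / m) powr (1 - r) * J) + (1 - 1 / r) * (n / m * (b - a))"
        using le[of "n / m"] nm by simp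
      ultimately have "(LINT s:{a..b}|lebesgue. \<bar>x s\<bar>)
          \<le> 1 / r * (n * (b - a) powr (1 - 1 / r)) + (1 - 1 / r) * (n * (b - a) powr (1 - 1 / r))"
        by metis
      then show ?thesis by (simp add: n_def algebra_simps)
    qed
    with int show ?thesis by (simp add: N r_def)
  qed
  then show "set_integrable lebesgue {a..b} x"
    "(LINT s:{a..b}|lebesgue. \<bar>x s\<bar>) \<le> Lp_norm p x * (b - a) powr (1 - 1 / enn2real p)"
    by auto
qed

lemma Lp_bounded_on_interval:
  assumes p: "1 \<le> p" and ab: "a < b" and fm [measurable]: "f \<in> borel_measurable lebesgue"
    and f: "\<And>t. \<bar>f t\<bar> \<le> M * indicator {a..b} t"
  shows "f \<in> Lp_space p"
    and "Lp_norm p f \<le> M * (b - a) powr (1 / enn2real p)"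
proof -
  have M: "0 \<le> M" using f[of a] ab by (auto intro: order_trans[OF abs_ge_zero])
  have "f \<in> Lp_space p \<and> Lp_norm p f \<le> M * (b - a) powr (1 / enn2real p)"
  proof (cases "p = \<infinity>")
    case True
    have "\<bar>f t\<bar> \<le> M" for t
      using f[of t] M by (cases "t \<in> {a..b}") auto
    then have "esssup lebesgue (\<lambda>t. ennreal \<bar>f t\<bar>) \<le> ennreal M"
      by (intro esssup_I) (auto intro: ennreal_leI)
    moreover from this have "enn2real (esssup lebesgue (\<lambda>t. ennreal \<bar>f t\<bar>)) \<le> M"
      using M enn2real_mono[of _ "ennreal M"] by fastforce
    ultimately show ?thesis
      using True ab fm by (auto simp: Lp_space_def Lp_norm_def intro: le_less_trans)
  next
    case False
    define r where "r = enn2real p"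
    have r: "1 \<le> r" using enn2real_ge_1 p False by (simp add: r_def)
    have le: "\<bar>f t\<bar> powr r \<le> M powr r * indicator {a..b} t" for t
      using f[of t] r by (cases "t \<in> {a..b}") (auto intro: powr_mono2)
    have ind: "integrable lebesgue (\<lambda>t. M powr r * indicator {a..b} t :: real)"
      by (intro integrable_mult_right integrable_real_indicator) (use ab in auto)
    have int: "integrable lebesgue (\<lambda>t. \<bar>f t\<bar> powr r)"
      by (rule Bochner_Integration.integrable_bound[OF ind])
        (use le in \<open>auto intro!: AE_I2 order_trans[OF _ abs_ge_self]\<close>)
    have "(LINT t|lebesgue. \<bar>f t\<bar> powr r) \<le> (LINT t|lebesgue. M powr r * indicator {a..b} t)"
      using le by (intro integral_mono int ind)
    also have "\<dots> = M powr r * (b - a)" using ab by simp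
    finally have "(LINT t|lebesgue. \<bar>f t\<bar> powr r) powr (1 / r) \<le> (M powr r * (b - a)) powr (1 / r)"
      using r by (intro powr_mono2) auto
    also have "\<dots> = M * (b - a) powr (1 / r)"
      using M ab r by (simp add: powr_mult powr_powr)
    finally show ?thesis using False int fm by (simp add: Lp_space_def Lp_norm_def r_def)
  qed
  then show "f \<in> Lp_space p" "Lp_norm p f \<le> M * (b - a) powr (1 / enn2real p)" by auto
qed

text \<open>
  The three cases in the definition of \<^const>\<open>lambda_tilde\<close> are one formula when \<open>1 / p\<close> is read as
  \<open>1 / enn2real p\<close>, with value \<open>0\<close> at \<open>p = \<infinity>\<close>. It is the product of the constants in the two bounds above.
\<close>

lemma lambda_tilde_eq:
  assumes "1 \<le> p" "\<alpha>1 < \<beta>1" "\<alpha> < \<beta>"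
  shows "lambda_tilde p \<alpha>1 \<beta>1 \<alpha> \<beta>
    = (\<beta> - \<alpha>) powr (1 / enn2real p) * (\<beta>1 - \<alpha>1) powr (1 - 1 / enn2real p)"
proof -
  consider "p = \<infinity>" | "p = 1" | "p \<noteq> \<infinity>" "p \<noteq> 1" by blast
  then show ?thesis
  proof cases
    case 3
    then have "enn2real p \<noteq> 1" "1 \<le> enn2real p"
      using enn2real_ge_1[OF assms(1)] ennreal_enn2real[of p] by (auto simp: less_top[symmetric])
    then have "1 / (enn2real p / (enn2real p - 1)) = 1 - 1 / enn2real p"
      by (simp add: field_simps)
    with 3 show ?thesis using assms by (simp add: lambda_tilde_def Let_def)
  qed (use assms in \<open>auto simp: lambda_tilde_def\<close>)
qed

lemma continuous_imp_lebesgue_measurable: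
  fixes g :: "real \<Rightarrow> real"
  assumes "continuous_on UNIV g"
  shows "g \<in> borel_measurable lebesgue"
  using borel_measurable_continuous_onI[OF assms] by (intro measurable_completion) simp

lemma set_integrable_bounded_continuous_mult:
  fixes g x :: "real \<Rightarrow> real"
  assumes g: "continuous_on UNIV g" "\<And>s. \<bar>g s\<bar> \<le> 1" and x: "set_integrable lebesgue S x"
  shows "set_integrable lebesgue S (\<lambda>s. g s * x s)"
proof (rule set_integrable_bound[OF x])
  have "(\<lambda>s. g s * (indicator S s *\<^sub>R x s)) \<in> borel_measurable lebesgue"
    using x continuous_imp_lebesgue_measurable[OF g(1)]
    by (intro borel_measurable_times) (auto simp: set_integrable_def)
  then show "set_borel_measurable lebesgue S (\<lambda>s. g s * x s)"
    by (simp add: set_borel_measurable_def mult_ac)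
  show "AE s in lebesgue. s \<in> S \<longrightarrow> norm (g s * x s) \<le> norm (x s)"
    using g(2) by (simp add: abs_mult mult_left_le_one_le)
qed

section \<open>Trigonometric operators of rank two\<close>

text \<open>
  On the window \<open>[\<alpha>1, \<beta>1]\<close> sine and cosine are orthogonal, with squared norms \<open>\<sigma>1\<close> and \<open>\<sigma>2\<close>. Both
  kinds of parameters in the theorem provide this situation: those with an integrality condition on
  \<open>\<omega>\<close> and those in \<^const>\<open>Lambda_set\<close>.
\<close>

locale trig_window =
  fixes \<alpha>1 \<beta>1 \<alpha> \<beta> \<omega> \<sigma>1 \<sigma>2 :: real
  assumes window: "\<alpha>1 < \<beta>1" "\<alpha> \<le> \<alpha>1" "\<beta>1 \<le> \<beta>"
    and orthogonal: "(LINT s:{\<alpha>1..\<beta>1}|lebesgue. sin (\<omega> * s) * cos (\<omega> * s)) = 0"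
    and \<sigma>1: "\<sigma>1 = (LINT s:{\<alpha>1..\<beta>1}|lebesgue. (sin (\<omega> * s))\<^sup>2)"
    and \<sigma>2: "\<sigma>2 = (LINT s:{\<alpha>1..\<beta>1}|lebesgue. (cos (\<omega> * s))\<^sup>2)"
begin

definition cos_coeff :: "(real \<Rightarrow> real) \<Rightarrow> real" where
  "cos_coeff x = (LINT s:{\<alpha>1..\<beta>1}|lebesgue. cos (\<omega> * s) * x s)"

definition sin_coeff :: "(real \<Rightarrow> real) \<Rightarrow> real" where
  "sin_coeff x = (LINT s:{\<alpha>1..\<beta>1}|lebesgue. sin (\<omega> * s) * x s)"

definition trig_op :: "real \<Rightarrow> real \<Rightarrow> real \<Rightarrow> (real \<Rightarrow> real) \<Rightarrow> real \<Rightarrow> real" where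
  "trig_op a b d x t = indicator {\<alpha>..\<beta>} t *
     ((a * cos_coeff x + d * sin_coeff x) * sin (\<omega> * t) + b * cos_coeff x * cos (\<omega> * t))"

abbreviation loc_int :: "(real \<Rightarrow> real) \<Rightarrow> bool" where
  "loc_int x \<equiv> set_integrable lebesgue {\<alpha>1..\<beta>1} x"

text \<open>
  Equality with \<open>trig_op a b d\<close> is demanded for all functions integrable on the window. These contain
  every \<open>L\<^sub>p\<close> space with \<open>p \<ge> 1\<close> and every output of \<open>trig_op\<close>, and sums and multiples of such functions are again
  integrable, so that a single calculus of coefficients, with pointwise equality, serves every exponent.
\<close>

definition has_coeffs ::
  "((real \<Rightarrow> real) \<Rightarrow> real \<Rightarrow> real) \<Rightarrow> real \<Rightarrow> real \<Rightarrow> real \<Rightarrow> bool" where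
  "has_coeffs T a b d \<longleftrightarrow> (\<forall>x. loc_int x \<longrightarrow> T x = trig_op a b d x)"

lemma loc_int_trig:
  assumes "loc_int x"
  shows "loc_int (\<lambda>s. cos (\<omega> * s) * x s)" "loc_int (\<lambda>s. sin (\<omega> * s) * x s)"
  by (intro set_integrable_bounded_continuous_mult continuous_intros assms abs_cos_le_one abs_sin_le_one)+

lemma has_coeffs_kernel_op:
  "has_coeffs (kernel_op \<alpha>1 \<beta>1 (\<lambda>t s. indicator {\<alpha>..\<beta>} t *
     (a * sin (\<omega> * t) * cos (\<omega> * s) + b * cos (\<omega> * t) * cos (\<omega> * s)
      + d * sin (\<omega> * t) * sin (\<omega> * s)))) a b d"
  unfolding has_coeffs_def
proof (intro allI impI ext)
  fix x t assume x: "loc_int x"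
  define k1 k2 where
    k: "k1 = indicator {\<alpha>..\<beta>} t * (a * sin (\<omega> * t) + b * cos (\<omega> * t))"
       "k2 = indicator {\<alpha>..\<beta>} t * (d * sin (\<omega> * t))"
  have "kernel_op \<alpha>1 \<beta>1 (\<lambda>t s. indicator {\<alpha>..\<beta>} t *
      (a * sin (\<omega> * t) * cos (\<omega> * s) + b * cos (\<omega> * t) * cos (\<omega> * s)
      + d * sin (\<omega> * t) * sin (\<omega> * s))) x t
    = (LINT s:{\<alpha>1..\<beta>1}|lebesgue. k1 * (cos (\<omega> * s) * x s) + k2 * (sin (\<omega> * s) * x s))"
    unfolding kernel_op_def k
    by (intro arg_cong[where f = "set_lebesgue_integral lebesgue {\<alpha>1..\<beta>1}"] ext)
      (simp add: algebra_simps)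
  also have "\<dots> = k1 * cos_coeff x + k2 * sin_coeff x"
    unfolding cos_coeff_def sin_coeff_def
    by (subst set_integral_add(2)) (intro set_integrable_mult_right loc_int_trig x | simp)+
  also have "\<dots> = trig_op a b d x t"
    by (simp add: k trig_op_def algebra_simps)
  finally show "kernel_op \<alpha>1 \<beta>1 (\<lambda>t s. indicator {\<alpha>..\<beta>} t *
      (a * sin (\<omega> * t) * cos (\<omega> * s) + b * cos (\<omega> * t) * cos (\<omega> * s)
      + d * sin (\<omega> * t) * sin (\<omega> * s))) x t = trig_op a b d x t" .
qed

lemma loc_int_continuous: "continuous_on UNIV g \<Longrightarrow> loc_int g"
  by (rule absolutely_integrable_continuous_real[OF continuous_on_subset]) auto

lemma trig_op_on_window:
  "s \<in> {\<alpha>1..\<beta>1} \<Longrightarrow> trig_op a b d x s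
    = (a * cos_coeff x + d * sin_coeff x) * sin (\<omega> * s) + b * cos_coeff x * cos (\<omega> * s)"
  using window by (simp add: trig_op_def)

lemma loc_int_trig_op: "loc_int (trig_op a b d x)"
  by (subst set_integrable_cong[OF refl refl trig_op_on_window])
    (auto intro!: loc_int_continuous continuous_intros)

text \<open>
  By orthogonality the cosine coefficient of the output is a multiple of that of the input, whatever
  its sine coefficient; this is why the triangular shape survives composition.
\<close>

lemma coeffs_trig_op:
  "cos_coeff (trig_op a b d x) = \<sigma>2 * b * cos_coeff x"
  "sin_coeff (trig_op a b d x) = \<sigma>1 * (a * cos_coeff x + d * sin_coeff x)"
proof -
  define u v where uv: "u = a * cos_coeff x + d * sin_coeff x" "v = b * cos_coeff x"
  have int: "loc_int (\<lambda>s. k * (sin (\<omega> * s) * cos (\<omega> * s)))"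
    "loc_int (\<lambda>s. k * (cos (\<omega> * s))\<^sup>2)" "loc_int (\<lambda>s. k * (sin (\<omega> * s))\<^sup>2)" for k
    by (intro loc_int_continuous continuous_intros)+
  have "cos_coeff (trig_op a b d x) = (LINT s:{\<alpha>1..\<beta>1}|lebesgue.
      u * (sin (\<omega> * s) * cos (\<omega> * s)) + v * (cos (\<omega> * s))\<^sup>2)"
    unfolding cos_coeff_def[of "trig_op a b d x"]
    by (rule set_lebesgue_integral_cong)
      (auto simp: trig_op_on_window uv algebra_simps power2_eq_square)
  also have "\<dots> = v * \<sigma>2"
    by (subst set_integral_add(2)) (rule int | simp add: orthogonal \<sigma>2)+
  finally show "cos_coeff (trig_op a b d x) = \<sigma>2 * b * cos_coeff x"
    by (simp add: uv)
  have "sin_coeff (trig_op a b d x) = (LINT s:{\<alpha>1..\<beta>1}|lebesgue.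
      v * (sin (\<omega> * s) * cos (\<omega> * s)) + u * (sin (\<omega> * s))\<^sup>2)"
    unfolding sin_coeff_def[of "trig_op a b d x"]
    by (rule set_lebesgue_integral_cong)
      (auto simp: trig_op_on_window uv algebra_simps power2_eq_square)
  also have "\<dots> = u * \<sigma>1"
    by (subst set_integral_add(2)) (rule int | simp add: orthogonal \<sigma>1)+
  finally show "sin_coeff (trig_op a b d x) = \<sigma>1 * (a * cos_coeff x + d * sin_coeff x)"
    by (simp add: uv)
qed

lemma has_coeffs_comp:
  assumes "has_coeffs S a b d" "has_coeffs T a' b' d'"
  shows "has_coeffs (S \<circ> T) (a * \<sigma>2 * b' + d * \<sigma>1 * a') (b * \<sigma>2 * b') (d * \<sigma>1 * d')"
proof -
  have "trig_op a b d (trig_op a' b' d' x)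
      = trig_op (a * \<sigma>2 * b' + d * \<sigma>1 * a') (b * \<sigma>2 * b') (d * \<sigma>1 * d') x" for x
    by (rule ext, subst trig_op_def, simp only: coeffs_trig_op)
      (simp add: trig_op_def algebra_simps)
  with assms show ?thesis by (simp add: has_coeffs_def loc_int_trig_op)
qed

lemma has_coeffs_diff:
  assumes "has_coeffs S a b d" "has_coeffs T a' b' d'"
  shows "has_coeffs (S - T) (a - a') (b - b') (d - d')"
  using assms by (auto simp: has_coeffs_def trig_op_def algebra_simps intro!: ext)

lemma has_coeffs_scale:
  assumes "has_coeffs T a b d"
  shows "has_coeffs (\<lambda>x t. c * T x t) (c * a) (c * b) (c * d)"
  using assms by (auto simp: has_coeffs_def trig_op_def algebra_simps intro!: ext)

lemma has_coeffs_zero: "has_coeffs (\<lambda>x t. 0) 0 0 0"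
  by (auto simp: has_coeffs_def trig_op_def)

section \<open>Norm bounds for trigonometric operators\<close>

lemma cos_coeff_linear:
  "loc_int x \<Longrightarrow> loc_int y \<Longrightarrow> cos_coeff (\<lambda>s. x s + y s) = cos_coeff x + cos_coeff y"
  "cos_coeff (\<lambda>s. c * x s) = c * cos_coeff x"
  by (simp_all add: cos_coeff_def distrib_left loc_int_trig mult.left_commute[of _ c])

lemma sin_coeff_linear:
  "loc_int x \<Longrightarrow> loc_int y \<Longrightarrow> sin_coeff (\<lambda>s. x s + y s) = sin_coeff x + sin_coeff y"
  "sin_coeff (\<lambda>s. c * x s) = c * sin_coeff x"
  by (simp_all add: sin_coeff_def distrib_left loc_int_trig mult.left_commute[of _ c])

lemma coeffs_cong_AE:
  assumes "loc_int x" "loc_int y" and ae: "AE t in lebesgue. x t = y t"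
  shows "cos_coeff x = cos_coeff y" "sin_coeff x = sin_coeff y"
proof -
  have "(\<lambda>s. indicator {\<alpha>1..\<beta>1} s *\<^sub>R (cos (\<omega> * s) * z s)) \<in> borel_measurable lebesgue"
    "(\<lambda>s. indicator {\<alpha>1..\<beta>1} s *\<^sub>R (sin (\<omega> * s) * z s)) \<in> borel_measurable lebesgue"
    if "loc_int z" for z
    using loc_int_trig[OF that] by (auto simp: set_integrable_def)
  with assms show "cos_coeff x = cos_coeff y" "sin_coeff x = sin_coeff y"
    unfolding cos_coeff_def sin_coeff_def set_lebesgue_integral_def
    by (intro integral_cong_AE; auto)+
qed

lemma coeffs_le_integral:
  assumes "loc_int x"
  shows "\<bar>cos_coeff x\<bar> \<le> (LINT s:{\<alpha>1..\<beta>1}|lebesgue. \<bar>x s\<bar>)"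
    and "\<bar>sin_coeff x\<bar> \<le> (LINT s:{\<alpha>1..\<beta>1}|lebesgue. \<bar>x s\<bar>)"
proof -
  have *: "\<bar>LINT s:{\<alpha>1..\<beta>1}|lebesgue. g s * x s\<bar> \<le> (LINT s:{\<alpha>1..\<beta>1}|lebesgue. \<bar>x s\<bar>)"
    if g: "loc_int (\<lambda>s. g s * x s)" "\<And>s. \<bar>g s\<bar> \<le> 1" for g
  proof -
    have "\<bar>LINT s:{\<alpha>1..\<beta>1}|lebesgue. g s * x s\<bar> \<le> (LINT s:{\<alpha>1..\<beta>1}|lebesgue. \<bar>g s * x s\<bar>)"
      using integral_norm_bound[of lebesgue "\<lambda>s. indicator {\<alpha>1..\<beta>1} s *\<^sub>R (g s * x s)"]
      by (simp add: set_lebesgue_integral_def abs_mult)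
    also have "\<dots> \<le> (LINT s:{\<alpha>1..\<beta>1}|lebesgue. \<bar>x s\<bar>)"
      using g assms by (intro set_integral_mono set_integrable_abs)
        (auto simp: abs_mult mult_left_le_one_le)
    finally show ?thesis .
  qed
  show "\<bar>cos_coeff x\<bar> \<le> (LINT s:{\<alpha>1..\<beta>1}|lebesgue. \<bar>x s\<bar>)"
    "\<bar>sin_coeff x\<bar> \<le> (LINT s:{\<alpha>1..\<beta>1}|lebesgue. \<bar>x s\<bar>)"
    unfolding cos_coeff_def sin_coeff_def
    by (intro * loc_int_trig assms abs_cos_le_one abs_sin_le_one)+
qed

lemma loc_int_Lp: "1 \<le> p \<Longrightarrow> x \<in> Lp_space p \<Longrightarrow> loc_int x"
  using Lp_integral_abs_le(1) window by blast

text \<open>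
  The window length enters through the coefficients of \<open>x\<close>, by Hoelder's inequality, and the length of
  \<open>[\<alpha>, \<beta>]\<close> through the support of the output; the product of the two powers is \<^const>\<open>lambda_tilde\<close>.
\<close>

lemma has_coeffs_Lp_bound:
  assumes p: "1 \<le> p" and T: "has_coeffs T a b d" and x: "x \<in> Lp_space p"
  shows "T x \<in> Lp_space p"
    and "Lp_norm p (T x) \<le> (\<bar>a\<bar> + \<bar>b\<bar> + \<bar>d\<bar>) * lambda_tilde p \<alpha>1 \<beta>1 \<alpha> \<beta> * Lp_norm p x"
proof -
  define K where "K = Lp_norm p x * (\<beta>1 - \<alpha>1) powr (1 - 1 / enn2real p)"
  have int: "loc_int x" by (rule loc_int_Lp[OF p x])
  have K: "\<bar>cos_coeff x\<bar> \<le> K" "\<bar>sin_coeff x\<bar> \<le> K"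
    using coeffs_le_integral[OF int] Lp_integral_abs_le(2)[OF p window(1) x] by (auto simp: K_def)
  have m: "trig_op a b d x \<in> borel_measurable lebesgue"
    unfolding trig_op_def
    by (intro borel_measurable_times borel_measurable_indicator continuous_imp_lebesgue_measurable
        continuous_intros) auto
  have "\<bar>(a * cos_coeff x + d * sin_coeff x) * sin (\<omega> * t) + b * cos_coeff x * cos (\<omega> * t)\<bar>
      \<le> (\<bar>a\<bar> + \<bar>b\<bar> + \<bar>d\<bar>) * K" for t
  proof -
    have "\<bar>(a * cos_coeff x + d * sin_coeff x) * sin (\<omega> * t) + b * cos_coeff x * cos (\<omega> * t)\<bar>
        \<le> \<bar>a * cos_coeff x + d * sin_coeff x\<bar> * \<bar>sin (\<omega> * t)\<bar> + \<bar>b * cos_coeff x\<bar> * \<bar>cos (\<omega> * t)\<bar>"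
      by (simp flip: abs_mult)
    also have "\<dots> \<le> \<bar>a * cos_coeff x + d * sin_coeff x\<bar> + \<bar>b * cos_coeff x\<bar>"
      by (intro add_mono mult_right_le_one_le) auto
    also have "\<dots> \<le> \<bar>a\<bar> * \<bar>cos_coeff x\<bar> + \<bar>d\<bar> * \<bar>sin_coeff x\<bar> + \<bar>b\<bar> * \<bar>cos_coeff x\<bar>"
      by (simp add: abs_mult[symmetric])
    also have "\<dots> \<le> \<bar>a\<bar> * K + \<bar>d\<bar> * K + \<bar>b\<bar> * K"
      by (intro add_mono mult_left_mono K) auto
    finally show ?thesis by (simp add: algebra_simps)
  qed
  then have "\<bar>trig_op a b d x t\<bar> \<le> (\<bar>a\<bar> + \<bar>b\<bar> + \<bar>d\<bar>) * K * indicator {\<alpha>..\<beta>} t" for t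
    by (cases "t \<in> {\<alpha>..\<beta>}") (auto simp: trig_op_def)
  note bounds = Lp_bounded_on_interval[OF p _ m this]
  have Tx: "T x = trig_op a b d x" using T int by (simp add: has_coeffs_def)
  show "T x \<in> Lp_space p" using bounds(1) window by (simp add: Tx)
  show "Lp_norm p (T x) \<le> (\<bar>a\<bar> + \<bar>b\<bar> + \<bar>d\<bar>) * lambda_tilde p \<alpha>1 \<beta>1 \<alpha> \<beta> * Lp_norm p x"
    using bounds(2) window p by (simp add: Tx K_def lambda_tilde_eq mult_ac)
qed

lemma has_coeffs_Lp_operator:
  assumes p: "1 \<le> p" and T: "has_coeffs T a b d"
  shows "Lp_operator p T"
  unfolding Lp_operator_def
proof (intro conjI ballI allI impI)
  have Tx: "T x = trig_op a b d x" if "loc_int x" for x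
    using T that by (simp add: has_coeffs_def)
  note int = loc_int_Lp[OF p]
  fix x y c assume x: "x \<in> Lp_space p"
  show "T x \<in> Lp_space p" using has_coeffs_Lp_bound(1)[OF p T x] .
  show "AE t in lebesgue. T (\<lambda>s. c * x s) t = c * T x t"
    using int[OF x] by (simp add: Tx trig_op_def cos_coeff_linear sin_coeff_linear algebra_simps)
  assume y: "y \<in> Lp_space p"
  show "AE t in lebesgue. T (\<lambda>s. x s + y s) t = T x t + T y t"
    using int[OF x] int[OF y]
    by (simp add: Tx trig_op_def cos_coeff_linear sin_coeff_linear algebra_simps)
  assume ae: "AE t in lebesgue. x t = y t"
  show "AE t in lebesgue. T x t = T y t"
    using coeffs_cong_AE[OF int[OF x] int[OF y] ae]
    by (simp add: Tx int x y trig_op_def)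
next
  show "\<exists>C. \<forall>x\<in>Lp_space p. Lp_norm p (T x) \<le> C * Lp_norm p x"
    using has_coeffs_Lp_bound(2)[OF p T] by blast
qed

lemma has_coeffs_Lp_op_eq:
  assumes "1 \<le> p" "has_coeffs S a b d" "has_coeffs T a b d"
  shows "Lp_op_eq p S T"
  using assms loc_int_Lp by (simp add: Lp_op_eq_def has_coeffs_def)

lemma has_coeffs_Lp_opnorm:
  assumes p: "1 \<le> p" and T: "has_coeffs T a b d"
  shows "\<bar>Lp_opnorm p T\<bar> \<le> (\<bar>a\<bar> + \<bar>b\<bar> + \<bar>d\<bar>) * lambda_tilde p \<alpha>1 \<beta>1 \<alpha> \<beta>"
proof -
  let ?U = "{x \<in> Lp_space p. Lp_norm p x \<le> 1}"
  let ?K = "(\<bar>a\<bar> + \<bar>b\<bar> + \<bar>d\<bar>) * lambda_tilde p \<alpha>1 \<beta>1 \<alpha> \<beta>"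
  have "0 \<le> ?K"
    using window p by (simp add: lambda_tilde_eq)
  then have le: "Lp_norm p (T x) \<le> ?K" if "x \<in> ?U" for x
    using has_coeffs_Lp_bound(2)[OF p T, of x] that
      mult_left_mono[of "Lp_norm p x" 1 ?K] by simp
  have zero: "(\<lambda>t. 0) \<in> ?U"
    using Lp_bounded_on_interval[OF p zero_less_one, of "\<lambda>t. 0" 0] by auto
  have "Lp_opnorm p T \<le> ?K"
    unfolding Lp_opnorm_def using zero by (intro cSUP_least le) auto
  moreover have "0 \<le> Lp_opnorm p T"
    unfolding Lp_opnorm_def
    by (rule cSUP_upper2[OF _ zero Lp_norm_nonneg]) (use le in \<open>auto simp: bdd_above_def\<close>)
  ultimately show ?thesis by simp
qed

text \<open>
  The coefficients of \<open>T n - S\<close> are the differences of the coefficients, so a fixed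
  multiple of the sum of their absolute values dominates the operator norm.
\<close>

lemma has_coeffs_tendsto:
  assumes p: "1 \<le> p" and T: "\<And>n. has_coeffs (T n) (a n) (b n) (d n)"
    and S: "has_coeffs S a' b' d'"
    and lim: "a \<longlonglongrightarrow> a'" "b \<longlonglongrightarrow> b'" "d \<longlonglongrightarrow> d'"
  shows "Lp_op_tendsto p T S"
  unfolding Lp_op_tendsto_def
proof (intro conjI allI)
  show "Lp_operator p (T n)" for n by (rule has_coeffs_Lp_operator[OF p T])
  show "Lp_operator p S" by (rule has_coeffs_Lp_operator[OF p S])
  have "(\<lambda>n. (\<bar>a n - a'\<bar> + \<bar>b n - b'\<bar> + \<bar>d n - d'\<bar>) * lambda_tilde p \<alpha>1 \<beta>1 \<alpha> \<beta>)
      \<longlonglongrightarrow> (\<bar>a' - a'\<bar> + \<bar>b' - b'\<bar> + \<bar>d' - d'\<bar>) * lambda_tilde p \<alpha>1 \<beta>1 \<alpha> \<beta>"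
    by (intro tendsto_intros lim)
  then have "(\<lambda>n. (\<bar>a n - a'\<bar> + \<bar>b n - b'\<bar> + \<bar>d n - d'\<bar>) * lambda_tilde p \<alpha>1 \<beta>1 \<alpha> \<beta>) \<longlonglongrightarrow> 0"
    by simp
  then show "(\<lambda>n. Lp_opnorm p (T n - S)) \<longlonglongrightarrow> 0"
    by (rule Lim_null_comparison[rotated])
      (use has_coeffs_Lp_opnorm[OF p has_coeffs_diff[OF T S]] in auto)
qed

section \<open>The twisted commutation relation and the commutator\<close>

lemma has_coeffs_op_A:
  "has_coeffs (op_A \<theta>A1 \<theta>A2 \<alpha>1 \<beta>1 \<alpha> \<beta> \<sigma>1 \<sigma>2 \<delta> \<omega>) \<theta>A1 \<theta>A2 (\<delta> * \<theta>A2\<^sup>2 * \<sigma>2\<^sup>2 / \<sigma>1)"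
  unfolding op_A_def by (rule has_coeffs_kernel_op)

lemma has_coeffs_sin_cos_kernel:
  "has_coeffs (kernel_op \<alpha>1 \<beta>1
     (\<lambda>t s. indicator {\<alpha>..\<beta>} t * (a * sin (\<omega> * t) * cos (\<omega> * s)))) a 0 0"
  using has_coeffs_kernel_op[of a 0 0] by simp

lemma has_coeffs_op_B: "has_coeffs (op_B \<theta>B1 \<alpha>1 \<beta>1 \<alpha> \<beta> \<omega>) \<theta>B1 0 0"
  unfolding op_B_def by (rule has_coeffs_sin_cos_kernel)

text \<open>
  The third coefficient of \<open>A\<close> is chosen so that its product with \<open>\<sigma>1\<close> is \<open>\<delta> (b \<sigma>2)\<^sup>2\<close>, that is, \<open>\<delta>\<close> times
  the square of the factor by which \<open>A\<close> scales the cosine coefficient. This lets the commutator factor as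
  stated and is also what makes the twisted relation below hold.
\<close>

lemma has_coeffs_commutator:
  assumes "has_coeffs A a b (\<delta> * b\<^sup>2 * \<sigma>2\<^sup>2 / \<sigma>1)" "has_coeffs B c 0 0" "\<sigma>1 \<noteq> 0"
  shows "has_coeffs ((A \<circ> B) - (B \<circ> A)) (b * \<sigma>2 * c * (\<delta> * b * \<sigma>2 - 1)) 0 0"
  using has_coeffs_diff[OF has_coeffs_comp[OF assms(1,2)] has_coeffs_comp[OF assms(2,1)]] assms(3)
  by (simp add: algebra_simps power2_eq_square)

lemma twisted_commutation:
  assumes p: "1 \<le> p" and A: "has_coeffs A a b (\<delta> * b\<^sup>2 * \<sigma>2\<^sup>2 / \<sigma>1)" and B: "has_coeffs B c 0 0"
    and "\<sigma>1 \<noteq> 0"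
  shows "Lp_op_eq p (A \<circ> B) (\<lambda>x t. \<delta> * (B \<circ> A \<circ> A) x t)"
proof (rule has_coeffs_Lp_op_eq[OF p])
  show "has_coeffs (A \<circ> B) (\<delta> * b\<^sup>2 * \<sigma>2\<^sup>2 * c) 0 0"
    using has_coeffs_comp[OF A B] \<open>\<sigma>1 \<noteq> 0\<close> by simp
  show "has_coeffs (\<lambda>x t. \<delta> * (B \<circ> A \<circ> A) x t) (\<delta> * b\<^sup>2 * \<sigma>2\<^sup>2 * c) 0 0"
    using has_coeffs_scale[OF has_coeffs_comp[OF has_coeffs_comp[OF B A] A], of \<delta>]
    by (simp add: algebra_simps power2_eq_square)
qed

end

text \<open>
  The integral equals \<open>sin (\<omega> (b + a)) sin (\<omega> (b - a)) / (2 \<omega>)\<close>, and each of the two alternatives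
  annihilates one factor.
\<close>

lemma integral_sin_cos_eq_0:
  fixes \<omega> :: real
  assumes "a < b" "\<omega> \<noteq> 0" "\<omega> / pi * (b - a) \<in> \<int> \<or> \<omega> / pi * (b + a) \<in> \<int>"
  shows "(LINT s:{a..b}|lebesgue. sin (\<omega> * s) * cos (\<omega> * s)) = 0"
proof -
  have "set_integrable lebesgue {a..b} (\<lambda>s. sin (\<omega> * s) * cos (\<omega> * s))"
    by (intro absolutely_integrable_continuous_real continuous_intros)
  then have "(LINT s:{a..b}|lebesgue. sin (\<omega> * s) * cos (\<omega> * s))
      = integral {a..b} (\<lambda>s. sin (\<omega> * s) * cos (\<omega> * s))"
    by (rule set_lebesgue_integral_eq_integral)
  also have "((\<lambda>s. sin (\<omega> * s) * cos (\<omega> * s)) has_integral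
      (sin (\<omega> * b))\<^sup>2 / (2 * \<omega>) - (sin (\<omega> * a))\<^sup>2 / (2 * \<omega>)) {a..b}"
    using assms by (intro fundamental_theorem_of_calculus)
      (auto intro!: derivative_eq_intros simp: has_real_derivative_iff_has_vector_derivative[symmetric] field_simps)
  then have "integral {a..b} (\<lambda>s. sin (\<omega> * s) * cos (\<omega> * s))
      = ((sin (\<omega> * b))\<^sup>2 - (sin (\<omega> * a))\<^sup>2) / (2 * \<omega>)"
    by (simp add: integral_unique diff_divide_distrib)
  also have "(sin (\<omega> * b))\<^sup>2 - (sin (\<omega> * a))\<^sup>2
      = sin (\<omega> / pi * (b + a) * pi) * sin (\<omega> / pi * (b - a) * pi)"
  proof -
    have prod: "sin (u + v) * sin (u - v) = (sin u)\<^sup>2 - (sin v)\<^sup>2" for u v :: real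
    proof -
      have "sin (u + v) * sin (u - v) = (sin u)\<^sup>2 * (cos v)\<^sup>2 - (cos u)\<^sup>2 * (sin v)\<^sup>2"
        by (simp add: sin_add sin_diff algebra_simps power2_eq_square)
      then show ?thesis by (simp add: cos_squared_eq algebra_simps)
    qed
    have "\<omega> * b + \<omega> * a = \<omega> / pi * (b + a) * pi" "\<omega> * b - \<omega> * a = \<omega> / pi * (b - a) * pi"
      by (simp_all add: field_simps)
    with prod[of "\<omega> * b" "\<omega> * a"] show ?thesis by metis
  qed
  also have "\<dots> = 0" using assms(3) by (metis mult_eq_0_iff sin_times_pi_eq_0)
  finally show ?thesis by simp
qed

lemma Lambda_set_trig_window:
  assumes "(\<theta>A1, \<theta>A2, \<theta>B1, \<alpha>1, \<beta>1, \<alpha>, \<beta>, \<sigma>1, \<sigma>2, \<delta>, \<omega>) \<in> Lambda_set"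
  shows "trig_window \<alpha>1 \<beta>1 \<alpha> \<beta> \<omega> \<sigma>1 \<sigma>2"
proof
  have L: "\<alpha>1 < \<beta>1" "\<alpha> \<le> \<alpha>1" "\<beta>1 \<le> \<beta>"
    "(LINT s:{\<alpha>1..\<beta>1}|lebesgue. sin (\<omega> * s) * cos (\<omega> * s)) = 0"
    "\<sigma>1 = (LINT s:{\<alpha>1..\<beta>1}|lebesgue. (sin (\<omega> * s))\<^sup>2)" "\<sigma>2 = \<beta>1 - \<alpha>1 - \<sigma>1"
    using assms by (auto simp: Lambda_set_def)
  have "(LINT s:{\<alpha>1..\<beta>1}|lebesgue. (cos (\<omega> * s))\<^sup>2)
      = (LINT s:{\<alpha>1..\<beta>1}|lebesgue. 1 - (sin (\<omega> * s))\<^sup>2)"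
    by (simp add: cos_squared_eq)
  also have "\<dots> = (LINT s:{\<alpha>1..\<beta>1}|lebesgue. 1) - \<sigma>1"
    unfolding L(5)
    by (intro set_integral_diff(2) absolutely_integrable_continuous_real continuous_intros)
  also have "(LINT s:{\<alpha>1..\<beta>1}|lebesgue. 1) = \<beta>1 - \<alpha>1"
    using L(1) by (simp add: set_integral_const)
  finally show "\<sigma>2 = (LINT s:{\<alpha>1..\<beta>1}|lebesgue. (cos (\<omega> * s))\<^sup>2)"
    using L(6) by simp
qed (use assms in \<open>auto simp: Lambda_set_def\<close>)

text \<open>
  The bound involves the parameters only through the quantity assumed to vanish in the limit, which makes
  it uniform in the way needed when all parameters vary at once.
\<close>

lemma commutator_Lp_norm_Lambda:
  assumes l: "(\<theta>A1, \<theta>A2, \<theta>B1, \<alpha>1, \<beta>1, \<alpha>, \<beta>, \<sigma>1, \<sigma>2, \<delta>, \<omega>) \<in> Lambda_set"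
    and p: "1 \<le> p" and x: "x \<in> Lp_space p"
    and A: "A = op_A \<theta>A1 \<theta>A2 \<alpha>1 \<beta>1 \<alpha> \<beta> \<sigma>1 \<sigma>2 \<delta> \<omega>" and B: "B = op_B \<theta>B1 \<alpha>1 \<beta>1 \<alpha> \<beta> \<omega>"
  shows "Lp_norm p (((A \<circ> B) - (B \<circ> A)) x)
    \<le> \<bar>\<theta>A2 * \<sigma>2 * \<theta>B1 * (\<delta> * \<theta>A2 * \<sigma>2 - 1) * lambda_tilde p \<alpha>1 \<beta>1 \<alpha> \<beta>\<bar> * Lp_norm p x"
proof -
  interpret trig_window \<alpha>1 \<beta>1 \<alpha> \<beta> \<omega> \<sigma>1 \<sigma>2 by (rule Lambda_set_trig_window[OF l])
  have "\<sigma>1 \<noteq> 0" using l by (simp add: Lambda_set_def)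
  then have "has_coeffs ((A \<circ> B) - (B \<circ> A)) (\<theta>A2 * \<sigma>2 * \<theta>B1 * (\<delta> * \<theta>A2 * \<sigma>2 - 1)) 0 0"
    unfolding A B by (rule has_coeffs_commutator[OF has_coeffs_op_A has_coeffs_op_B])
  moreover have "0 \<le> lambda_tilde p \<alpha>1 \<beta>1 \<alpha> \<beta>"
    using window p by (simp add: lambda_tilde_eq)
  ultimately show ?thesis
    using has_coeffs_Lp_bound(2)[OF p _ x] by (fastforce simp: abs_mult)
qed

theorem theorem6:
  fixes p :: ennreal
    and \<theta>A1 \<theta>A2 \<theta>B1 \<alpha>1 \<beta>1 \<alpha> \<beta> \<sigma>1 \<sigma>2 \<delta> \<omega> :: real
    and \<theta> \<zeta> :: "nat \<Rightarrow> real"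
    and A B Abar Atilde :: "(real \<Rightarrow> real) \<Rightarrow> real \<Rightarrow> real"
    and An Bn :: "nat \<Rightarrow> (real \<Rightarrow> real) \<Rightarrow> real \<Rightarrow> real"
  assumes "1 \<le> p"
    and "\<delta> \<noteq> 0" and "\<alpha>1 < \<beta>1" and "\<alpha> \<le> \<alpha>1" and "\<beta> \<ge> \<beta>1"
    and "\<omega> / pi * (\<beta>1 - \<alpha>1) \<in> \<int> \<or> \<omega> / pi * (\<beta>1 + \<alpha>1) \<in> \<int>"
    and "\<sigma>1 = (LINT s:{\<alpha>1..\<beta>1}|lebesgue. (sin (\<omega> * s))\<^sup>2)" and "\<sigma>1 \<noteq> 0"
    and "\<sigma>2 = (LINT s:{\<alpha>1..\<beta>1}|lebesgue. (cos (\<omega> * s))\<^sup>2)" and "\<sigma>2 \<noteq> 0"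
    and "A = op_A \<theta>A1 \<theta>A2 \<alpha>1 \<beta>1 \<alpha> \<beta> \<sigma>1 \<sigma>2 \<delta> \<omega>"
    and "B = op_B \<theta>B1 \<alpha>1 \<beta>1 \<alpha> \<beta> \<omega>"
    and "\<And>n. An n = op_A \<theta>A1 (\<theta> n) \<alpha>1 \<beta>1 \<alpha> \<beta> \<sigma>1 \<sigma>2 \<delta> \<omega>"
    and "\<And>n. Bn n = op_B (\<zeta> n) \<alpha>1 \<beta>1 \<alpha> \<beta> \<omega>"
    and "Abar = kernel_op \<alpha>1 \<beta>1
           (\<lambda>t s. indicator {\<alpha>..\<beta>} t * (\<theta>A1 * sin (\<omega> * t) * cos (\<omega> * s)))"
    and "Atilde = kernel_op \<alpha>1 \<beta>1
           (\<lambda>t s. indicator {\<alpha>..\<beta>} t *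
              (\<theta>A1 * sin (\<omega> * t) * cos (\<omega> * s)
               + 1 / (\<delta> * \<sigma>2) * cos (\<omega> * t) * cos (\<omega> * s)
               + 1 / (\<delta> * \<sigma>1) * sin (\<omega> * t) * sin (\<omega> * s)))"
  shows
    "Lp_operator p A \<and> Lp_operator p B \<and> (\<forall>n. Lp_operator p (An n) \<and> Lp_operator p (Bn n))

     \<and> Lp_op_eq p (A \<circ> B) (\<lambda>x t. \<delta> * (B \<circ> A \<circ> A) x t)
     \<and> (\<forall>n\<ge>1.
          Lp_op_eq p (An n \<circ> B) (\<lambda>x t. \<delta> * (B \<circ> An n \<circ> An n) x t) \<and>
          Lp_op_eq p (An n \<circ> Bn n) (\<lambda>x t. \<delta> * (Bn n \<circ> An n \<circ> An n) x t) \<and>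
          Lp_op_eq p (A \<circ> Bn n) (\<lambda>x t. \<delta> * (Bn n \<circ> A \<circ> A) x t))
     \<and> (\<forall>x\<in>Lp_space p. AE t in lebesgue.
          ((A \<circ> B) - (B \<circ> A)) x t =
            \<theta>A2 * \<sigma>2 * \<theta>B1 * (\<delta> * \<theta>A2 * \<sigma>2 - 1) *
            (LINT s:{\<alpha>1..\<beta>1}|lebesgue.
               indicator {\<alpha>..\<beta>} t * sin (\<omega> * t) * cos (\<omega> * s) * x s))

     \<and> (\<theta> \<longlonglongrightarrow> 0 \<longrightarrow>
          Lp_op_tendsto p An Abar \<and>
          Lp_op_tendsto p (\<lambda>n. (An n \<circ> B) - (B \<circ> An n)) (\<lambda>x t. 0) \<and>
          Lp_op_eq p (Abar \<circ> B) (B \<circ> Abar))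

     \<and> (\<theta> \<longlonglongrightarrow> 1 / (\<delta> * \<sigma>2) \<longrightarrow>
          Lp_op_tendsto p An Atilde \<and>
          Lp_op_tendsto p (\<lambda>n. (An n \<circ> B) - (B \<circ> An n)) (\<lambda>x t. 0) \<and>
          Lp_op_eq p (Atilde \<circ> B) (B \<circ> Atilde))

     \<and> (\<zeta> \<longlonglongrightarrow> 0 \<longrightarrow>
          Lp_op_tendsto p Bn (\<lambda>x t. 0) \<and>
          Lp_op_tendsto p (\<lambda>n. (A \<circ> Bn n) - (Bn n \<circ> A)) (\<lambda>x t. 0))

     \<and> ((\<theta> \<longlonglongrightarrow> 0 \<or> \<theta> \<longlonglongrightarrow> 1 / (\<delta> * \<sigma>2)) \<and> \<zeta> \<longlonglongrightarrow> 0 \<longrightarrow>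
          Lp_op_tendsto p (\<lambda>n. (An n \<circ> Bn n) - (Bn n \<circ> An n)) (\<lambda>x t. 0))

     \<and> (\<forall>l0\<in>closure Lambda_set.
          ((\<lambda>(\<theta>A1, \<theta>A2, \<theta>B1, \<alpha>1, \<beta>1, \<alpha>, \<beta>, \<sigma>1, \<sigma>2, \<delta>, \<omega>).
              \<theta>A2 * \<sigma>2 * \<theta>B1 * (\<delta> * \<theta>A2 * \<sigma>2 - 1) * lambda_tilde p \<alpha>1 \<beta>1 \<alpha> \<beta>)
            \<longlongrightarrow> 0) (at l0 within Lambda_set) \<longrightarrow>
          (\<forall>x\<in>Lp_space p.
             ((\<lambda>(\<theta>A1, \<theta>A2, \<theta>B1, \<alpha>1, \<beta>1, \<alpha>, \<beta>, \<sigma>1, \<sigma>2, \<delta>, \<omega>).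
                 let A' = op_A \<theta>A1 \<theta>A2 \<alpha>1 \<beta>1 \<alpha> \<beta> \<sigma>1 \<sigma>2 \<delta> \<omega>;
                     B' = op_B \<theta>B1 \<alpha>1 \<beta>1 \<alpha> \<beta> \<omega>
                 in Lp_norm p (((A' \<circ> B') - (B' \<circ> A')) x))
               \<longlongrightarrow> 0) (at l0 within Lambda_set)))"
proof -
  note defs = assms(11-16)
  (* For a zero frequency the integral of sin squared, hence sigma1, would vanish. *)
  have "\<omega> \<noteq> 0"
    using assms(7,8) by auto
  then interpret trig_window \<alpha>1 \<beta>1 \<alpha> \<beta> \<omega> \<sigma>1 \<sigma>2
    using integral_sin_cos_eq_0 assms(3-7,9) by unfold_locales auto
  note p = \<open>1 \<le> p\<close>
  note comm = has_coeffs_commutator[OF _ _ \<open>\<sigma>1 \<noteq> 0\<close>]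
  have hA: "has_coeffs A \<theta>A1 \<theta>A2 (\<delta> * \<theta>A2\<^sup>2 * \<sigma>2\<^sup>2 / \<sigma>1)"
    and hAn: "has_coeffs (An n) \<theta>A1 (\<theta> n) (\<delta> * (\<theta> n)\<^sup>2 * \<sigma>2\<^sup>2 / \<sigma>1)" for n
    unfolding defs by (rule has_coeffs_op_A)+
  have hB: "has_coeffs B \<theta>B1 0 0" and hBn: "has_coeffs (Bn n) (\<zeta> n) 0 0" for n
    unfolding defs by (rule has_coeffs_op_B)+
  have hAbar: "has_coeffs Abar \<theta>A1 0 0"
    unfolding defs by (rule has_coeffs_sin_cos_kernel)
  have hAtilde: "has_coeffs Atilde \<theta>A1 (1 / (\<delta> * \<sigma>2)) (1 / (\<delta> * \<sigma>1))"
    unfolding defs by (rule has_coeffs_kernel_op)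

  have formula: "\<forall>x\<in>Lp_space p. AE t in lebesgue. ((A \<circ> B) - (B \<circ> A)) x t =
      \<theta>A2 * \<sigma>2 * \<theta>B1 * (\<delta> * \<theta>A2 * \<sigma>2 - 1) *
      (LINT s:{\<alpha>1..\<beta>1}|lebesgue. indicator {\<alpha>..\<beta>} t * sin (\<omega> * t) * cos (\<omega> * s) * x s)"
    using has_coeffs_Lp_op_eq[OF p comm[OF hA hB]
        has_coeffs_scale[OF has_coeffs_sin_cos_kernel[of 1],
          of "\<theta>A2 * \<sigma>2 * \<theta>B1 * (\<delta> * \<theta>A2 * \<sigma>2 - 1)", simplified mult_1_right mult_zero_right]]
    by (simp add: Lp_op_eq_def kernel_op_def mult.assoc)

  (* The commutator has at most one nonzero coefficient, so only that one must tend to zero;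
     this covers the constant sequences A and B as well. *)
  have comm_lim: "Lp_op_tendsto p (\<lambda>n. (S n \<circ> T n) - (T n \<circ> S n)) (\<lambda>x t. 0)"
    if "\<And>n. has_coeffs (S n) \<theta>A1 (b n) (\<delta> * (b n)\<^sup>2 * \<sigma>2\<^sup>2 / \<sigma>1)" "\<And>n. has_coeffs (T n) (c n) 0 0"
      "(\<lambda>n. b n * \<sigma>2 * c n * (\<delta> * b n * \<sigma>2 - 1)) \<longlonglongrightarrow> 0" for S T b c
    by (rule has_coeffs_tendsto[OF p comm[OF that(1,2)] has_coeffs_zero that(3)]) auto

  have part2: "Lp_op_tendsto p An Abar \<and>
      Lp_op_tendsto p (\<lambda>n. (An n \<circ> B) - (B \<circ> An n)) (\<lambda>x t. 0) \<and>
      Lp_op_eq p (Abar \<circ> B) (B \<circ> Abar)" if lim: "\<theta> \<longlonglongrightarrow> 0"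
  proof (intro conjI)
    have "(\<lambda>n. \<delta> * (\<theta> n)\<^sup>2 * \<sigma>2\<^sup>2 / \<sigma>1) \<longlonglongrightarrow> \<delta> * 0\<^sup>2 * \<sigma>2\<^sup>2 / \<sigma>1"
      using \<open>\<sigma>1 \<noteq> 0\<close> by (intro tendsto_intros lim)
    then show "Lp_op_tendsto p An Abar"
      by (intro has_coeffs_tendsto[OF p hAn hAbar] lim) auto
    have "(\<lambda>n. \<theta> n * \<sigma>2 * \<theta>B1 * (\<delta> * \<theta> n * \<sigma>2 - 1)) \<longlonglongrightarrow> 0 * \<sigma>2 * \<theta>B1 * (\<delta> * 0 * \<sigma>2 - 1)"
      by (intro tendsto_intros lim)
    then show "Lp_op_tendsto p (\<lambda>n. (An n \<circ> B) - (B \<circ> An n)) (\<lambda>x t. 0)"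
      by (intro comm_lim[OF hAn hB]) simp
    show "Lp_op_eq p (Abar \<circ> B) (B \<circ> Abar)"
      using has_coeffs_comp[OF hAbar hB] has_coeffs_comp[OF hB hAbar]
      by (intro has_coeffs_Lp_op_eq[OF p, where a = 0 and b = 0 and d = 0]) simp_all
  qed

  have part3: "Lp_op_tendsto p An Atilde \<and>
      Lp_op_tendsto p (\<lambda>n. (An n \<circ> B) - (B \<circ> An n)) (\<lambda>x t. 0) \<and>
      Lp_op_eq p (Atilde \<circ> B) (B \<circ> Atilde)" if lim: "\<theta> \<longlonglongrightarrow> 1 / (\<delta> * \<sigma>2)"
  proof (intro conjI)
    have "(\<lambda>n. \<delta> * (\<theta> n)\<^sup>2 * \<sigma>2\<^sup>2 / \<sigma>1) \<longlonglongrightarrow> \<delta> * (1 / (\<delta> * \<sigma>2))\<^sup>2 * \<sigma>2\<^sup>2 / \<sigma>1"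
      using \<open>\<sigma>1 \<noteq> 0\<close> by (intro tendsto_intros lim)
    also have "\<delta> * (1 / (\<delta> * \<sigma>2))\<^sup>2 * \<sigma>2\<^sup>2 / \<sigma>1 = 1 / (\<delta> * \<sigma>1)"
      using assms(2,8,10) by (simp add: field_simps power2_eq_square)
    finally show "Lp_op_tendsto p An Atilde"
      by (intro has_coeffs_tendsto[OF p hAn hAtilde] lim) auto
    have "(\<lambda>n. \<theta> n * \<sigma>2 * \<theta>B1 * (\<delta> * \<theta> n * \<sigma>2 - 1))
        \<longlonglongrightarrow> 1 / (\<delta> * \<sigma>2) * \<sigma>2 * \<theta>B1 * (\<delta> * (1 / (\<delta> * \<sigma>2)) * \<sigma>2 - 1)"
      by (intro tendsto_intros lim)
    then show "Lp_op_tendsto p (\<lambda>n. (An n \<circ> B) - (B \<circ> An n)) (\<lambda>x t. 0)"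
      using assms(2,10) by (intro comm_lim[OF hAn hB]) simp
    show "Lp_op_eq p (Atilde \<circ> B) (B \<circ> Atilde)"
      using has_coeffs_comp[OF hAtilde hB] has_coeffs_comp[OF hB hAtilde] assms(2,8,10)
      by (intro has_coeffs_Lp_op_eq[OF p, where a = "\<theta>B1 / \<delta>" and b = 0 and d = 0])
        (simp_all add: field_simps)
  qed

  have part4: "Lp_op_tendsto p Bn (\<lambda>x t. 0) \<and>
      Lp_op_tendsto p (\<lambda>n. (A \<circ> Bn n) - (Bn n \<circ> A)) (\<lambda>x t. 0)" if lim: "\<zeta> \<longlonglongrightarrow> 0"
  proof
    show "Lp_op_tendsto p Bn (\<lambda>x t. 0)"
      by (rule has_coeffs_tendsto[OF p hBn has_coeffs_zero lim]) auto
    have "(\<lambda>n. \<theta>A2 * \<sigma>2 * \<zeta> n * (\<delta> * \<theta>A2 * \<sigma>2 - 1)) \<longlonglongrightarrow> \<theta>A2 * \<sigma>2 * 0 * (\<delta> * \<theta>A2 * \<sigma>2 - 1)"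
      by (intro tendsto_intros lim)
    then show "Lp_op_tendsto p (\<lambda>n. (A \<circ> Bn n) - (Bn n \<circ> A)) (\<lambda>x t. 0)"
      by (intro comm_lim[OF hA hBn]) simp
  qed

  have part5: "Lp_op_tendsto p (\<lambda>n. (An n \<circ> Bn n) - (Bn n \<circ> An n)) (\<lambda>x t. 0)"
    if lim: "\<theta> \<longlonglongrightarrow> k" "\<zeta> \<longlonglongrightarrow> 0" for k
  proof -
    have "(\<lambda>n. \<theta> n * \<sigma>2 * \<zeta> n * (\<delta> * \<theta> n * \<sigma>2 - 1)) \<longlonglongrightarrow> k * \<sigma>2 * 0 * (\<delta> * k * \<sigma>2 - 1)"
      by (intro tendsto_intros lim)
    then show ?thesis by (intro comm_lim[OF hAn hBn]) simp
  qed

  have part6: "((\<lambda>(\<theta>A1, \<theta>A2, \<theta>B1, \<alpha>1, \<beta>1, \<alpha>, \<beta>, \<sigma>1, \<sigma>2, \<delta>, \<omega>).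
         let A' = op_A \<theta>A1 \<theta>A2 \<alpha>1 \<beta>1 \<alpha> \<beta> \<sigma>1 \<sigma>2 \<delta> \<omega>;
             B' = op_B \<theta>B1 \<alpha>1 \<beta>1 \<alpha> \<beta> \<omega>
         in Lp_norm p (((A' \<circ> B') - (B' \<circ> A')) x)) \<longlongrightarrow> 0) (at l0 within Lambda_set)"
    (is "(?F \<longlongrightarrow> 0) _")
    if lim: "((\<lambda>(\<theta>A1, \<theta>A2, \<theta>B1, \<alpha>1, \<beta>1, \<alpha>, \<beta>, \<sigma>1, \<sigma>2, \<delta>, \<omega>).
        \<theta>A2 * \<sigma>2 * \<theta>B1 * (\<delta> * \<theta>A2 * \<sigma>2 - 1) * lambda_tilde p \<alpha>1 \<beta>1 \<alpha> \<beta>)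
        \<longlongrightarrow> 0) (at l0 within Lambda_set)" (is "(?G \<longlongrightarrow> 0) _")
      and x: "x \<in> Lp_space p" for l0 x
  proof (rule Lim_null_comparison)
    have "norm (?F l) \<le> \<bar>?G l\<bar> * Lp_norm p x" if "l \<in> Lambda_set" for l
    proof -
      obtain a b c d e f g where "l = (a, b, c, d, e, f, g)"
        by (cases l rule: prod_cases7)
      moreover obtain h i j k m where "g = (h, i, j, k, m)"
        by (cases g rule: prod_cases5)
      ultimately show ?thesis
        using that commutator_Lp_norm_Lambda[OF _ p x refl refl, of a b c d e f h i j k m]
        by (simp add: Let_def Lp_norm_nonneg)
    qed
    then show "\<forall>\<^sub>F l in at l0 within Lambda_set. norm (?F l) \<le> \<bar>?G l\<bar> * Lp_norm p x"
      by (auto simp: eventually_at_filter)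
    show "((\<lambda>l. \<bar>?G l\<bar> * Lp_norm p x) \<longlongrightarrow> 0) (at l0 within Lambda_set)"
      using tendsto_mult_left_zero[OF tendsto_rabs_zero[OF lim]] .
  qed

  show ?thesis
    using has_coeffs_Lp_operator[OF p] hA hB hAn hBn formula part2 part3 part4 part5 part6
      twisted_commutation[OF p _ _ \<open>\<sigma>1 \<noteq> 0\<close>]
    by (intro conjI allI impI ballI) blast+
qed

end
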